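(* Let $n\ge 1$. The map $c\mapsto\mathcal{P}_c$ is a bijection between the set of coloring vectors of $\mathbb{Z}^n$ and the set of tagged partitions of $C=\{1,\ldots,n\}$, where $\mathcal{P}_c$ is regarded as a tagged partition via its associated partial involution.
   Context: An element $c\in\mathbb{Z}^n$ is a coloring vector if $c_1\in\{0,1\}$ and $-m_i\le c_i\le 1+m_i$ for all $i\in\{2,\ldots,n\}$, where $m_i:=\max\{c_1,\ldots,c_{i-1}\}$. A partial involution on a set $X$ is a function $x\mapsto x^*:\tilde X\to\tilde X$ defined on a subset $\tilde X\subseteq X$ that is its own inverse ($x^{**}=x$). A tagged partition of a finite set $C$ is a partition $\mathcal{P}$ of $C$ together with a partial involution $P\mapsto P^*:\tilde{\mathcal{P}}\to\tilde{\mathcal{P}}$ on $\mathcal{P}$ (with $\tilde{\mathcal{P}}\subseteq\mathcal{P}$) that has at most one fixed point. Two tagged partitions are equal if both the partitions and the partial involutions (including their domains) agree. For a coloring vector $c\in\mathbb{Z}^n$, put $[i]:=\{j\mid c_j=c_i\}$ and $[i]^*:=\{j\mid c_j=-c_i\}$. Then $\mathcal{P}_c:=\{[i]\mid i\in\{1,\ldots,n\}\}$, endowed with the partial involution $[i]\mapsto[i]^*$ on $\tilde{\mathcal{P}}=\{[i]\mid [i]^*\ne\emptyset\}$; this is a tagged partition of $C=\{1,\ldots,n\}$. *)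

theory Defs
  imports Complex_Main "HOL-Library.FuncSet" "HOL-Library.Disjoint_Sets"
begin

text \<open>
  Vectors of \<open>\<int>\<^sup>n\<close> are functions in \<open>{1..n} \<rightarrow>\<^sub>E UNIV\<close>; extensionality (the value
  \<open>undefined\<close> outside \<open>{1..n}\<close>) makes equality of functions coincide with equality of vectors.
\<close>

definition coloring_vector :: "nat \<Rightarrow> (nat \<Rightarrow> int) \<Rightarrow> bool" where
  "coloring_vector n c \<longleftrightarrow>
     c \<in> {1..n} \<rightarrow>\<^sub>E UNIV \<and>
     c 1 \<in> {0, 1} \<and>
     (\<forall>i\<in>{2..n}. let m = Max (c ` {1..<i}) in - m \<le> c i \<and> c i \<le> 1 + m)"

text \<open>
  A partial function with domain \<open>dom f\<close> is a map \<open>'a \<Rightarrow> 'a option\<close>, so equality of maps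
  includes equality of domains.
\<close>

definition partial_involution_on :: "'a set \<Rightarrow> ('a \<Rightarrow> 'a option) \<Rightarrow> bool" where
  "partial_involution_on X f \<longleftrightarrow>
     dom f \<subseteq> X \<and> ran f \<subseteq> dom f \<and> (\<forall>x\<in>dom f. (f \<circ>\<^sub>m f) x = Some x)"

type_synonym 'a tagged = "'a set set \<times> ('a set \<Rightarrow> 'a set option)"

definition tagged_partition_on :: "'a set \<Rightarrow> 'a tagged \<Rightarrow> bool" where
  "tagged_partition_on C T \<longleftrightarrow>
     (case T of (P, f) \<Rightarrow>
        partition_on C P \<and> partial_involution_on P f \<and>
        (\<forall>A B. f A = Some A \<longrightarrow> f B = Some B \<longrightarrow> A = B))"

definition color_class :: "nat \<Rightarrow> (nat \<Rightarrow> int) \<Rightarrow> nat \<Rightarrow> nat set" where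
  "color_class n c i = {j \<in> {1..n}. c j = c i}"

definition opp_class :: "nat \<Rightarrow> (nat \<Rightarrow> int) \<Rightarrow> nat \<Rightarrow> nat set" where
  "opp_class n c i = {j \<in> {1..n}. c j = - c i}"

definition color_partition :: "nat \<Rightarrow> (nat \<Rightarrow> int) \<Rightarrow> nat set set" where
  "color_partition n c = color_class n c ` {1..n}"

text \<open>
  The description does not depend on the representative \<open>i\<close> of the class \<open>B\<close>;
  see \<open>color_involution_class\<close> and \<open>dom_color_involution\<close> below.
\<close>

definition color_involution :: "nat \<Rightarrow> (nat \<Rightarrow> int) \<Rightarrow> nat set \<Rightarrow> nat set option" where
  "color_involution n c B =
     (if \<exists>i\<in>{1..n}. B = color_class n c i \<and> opp_class n c i \<noteq> {}
      then Some (THE B'. \<exists>i\<in>{1..n}. B = color_class n c i \<and> B' = opp_class n c i)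
      else None)"

definition color_tagged_partition :: "nat \<Rightarrow> (nat \<Rightarrow> int) \<Rightarrow> nat tagged" where
  "color_tagged_partition n c = (color_partition n c, color_involution n c)"

lemma opp_class_cong:
  assumes "i \<in> {1..n}" "color_class n c i = color_class n c k"
  shows "opp_class n c i = opp_class n c k"
proof -
  have "i \<in> color_class n c k"
    using assms by (auto simp: color_class_def)
  then show ?thesis
    by (auto simp: color_class_def opp_class_def)
qed

lemma color_involution_class:
  assumes "i \<in> {1..n}"
  shows "color_involution n c (color_class n c i) =
           (if opp_class n c i = {} then None else Some (opp_class n c i))"
proof -
  have "(THE B'. \<exists>k\<in>{1..n}. color_class n c i = color_class n c k \<and> B' = opp_class n c k)
          = opp_class n c i"
    using assms opp_class_cong by (intro the_equality) metis+
  moreover have "(\<exists>k\<in>{1..n}. color_class n c i = color_class n c k \<and> opp_class n c k \<noteq> {})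
          \<longleftrightarrow> opp_class n c i \<noteq> {}"
    using assms opp_class_cong by metis
  ultimately show ?thesis
    by (simp add: color_involution_def)
qed

lemma dom_color_involution:
  "dom (color_involution n c) = color_class n c ` {i \<in> {1..n}. opp_class n c i \<noteq> {}}"
  by (auto simp: dom_def color_involution_def split: if_splits)

end

theory Submission
  imports Defs
begin

text \<open>
  In a coloring vector the positive colors first occur in the order \<open>1, 2, 3, \<dots>\<close>, and \<open>-k\<close> occurs
  only after \<open>k\<close>. Reading the positions from left to right, the tagged partition thus determines
  the color of \<open>i\<close>: it is \<open>0\<close> if the block of \<open>i\<close> is the fixed point, the color already given to
  the block of \<open>i\<close>, or the negative of the color already given to the partner block, and otherwise
  the first unused positive number. The same rule constructs a coloring vector from any tagged
  partition.
\<close>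

section \<open>Running maxima and the bounds on colors\<close>

text \<open>The inserted 0 keeps \<open>Max\<close> defined at \<open>i = 1\<close>, where it turns
  the general bounds into 0 and 1, so the first entry needs no clause of its own.\<close>

definition prefix_max :: "(nat \<Rightarrow> int) \<Rightarrow> nat \<Rightarrow> int" where
  "prefix_max c i = Max (insert 0 (c ` {1..<i}))"

definition prefix_bounded :: "nat \<Rightarrow> (nat \<Rightarrow> int) \<Rightarrow> bool" where
  "prefix_bounded n c \<longleftrightarrow> (\<forall>i\<in>{1..n}. - prefix_max c i \<le> c i \<and> c i \<le> 1 + prefix_max c i)"

lemma prefix_max_nonneg: "0 \<le> prefix_max c i"
  by (simp add: prefix_max_def)

lemma le_prefix_max: "1 \<le> j \<Longrightarrow> j < i \<Longrightarrow> c j \<le> prefix_max c i"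
  unfolding prefix_max_def by (rule Max_ge) auto

lemma prefix_max_mono: "i \<le> j \<Longrightarrow> prefix_max c i \<le> prefix_max c j"
  unfolding prefix_max_def by (rule Max_mono) auto

lemma prefix_max_cong: "(\<And>j. 1 \<le> j \<Longrightarrow> j < i \<Longrightarrow> c j = d j) \<Longrightarrow> prefix_max c i = prefix_max d i"
  unfolding prefix_max_def by (rule arg_cong[where f = Max]) (auto simp: image_iff)

lemma prefix_max_Suc_0: "prefix_max c (Suc 0) = 0"
  by (simp add: prefix_max_def)

lemma prefix_max_Suc: "1 \<le> i \<Longrightarrow> prefix_max c (Suc i) = max (prefix_max c i) (c i)"
  by (simp add: prefix_max_def atLeastLessThanSuc insert_commute[of 0] max.commute)

lemma prefix_bounded_cong:
  assumes "\<And>j. j \<in> {1..n} \<Longrightarrow> c j = d j"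
  shows "prefix_bounded n c \<longleftrightarrow> prefix_bounded n d"
proof -
  have "prefix_max c i = prefix_max d i" if "i \<in> {1..n}" for i
    using that assms by (intro prefix_max_cong) auto
  then show ?thesis
    using assms by (simp add: prefix_bounded_def)
qed

lemma prefix_bounded_Suc:
  "prefix_bounded (Suc n) c \<longleftrightarrow> prefix_bounded n c \<and>
     - prefix_max c (Suc n) \<le> c (Suc n) \<and> c (Suc n) \<le> 1 + prefix_max c (Suc n)"
  by (auto simp: prefix_bounded_def atLeastAtMostSuc_conv)

text \<open>Since \<open>c 1\<close> is 0 or 1, the maximum of a nonempty prefix is already
  nonnegative, and inserting 0 does not change it.\<close>

lemma coloring_vector_iff:
  assumes "n \<ge> 1"
  shows "coloring_vector n c \<longleftrightarrow> c \<in> {1..n} \<rightarrow>\<^sub>E UNIV \<and> prefix_bounded n c"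
proof -
  have split: "{1..n} = insert 1 {2..n}"
    using assms by auto
  have "Max (c ` {1..<i}) = prefix_max c i" if "c 1 \<in> {0, 1}" "i \<in> {2..n}" for i
  proof -
    have "c 1 \<le> Max (c ` {1..<i})"
      using that by (intro Max_ge) auto
    moreover have "0 \<le> c 1"
      using that(1) by auto
    ultimately have "0 \<le> Max (c ` {1..<i})"
      by linarith
    then show ?thesis
      using that by (simp add: prefix_max_def)
  qed
  moreover have "c 1 \<in> {0, 1} \<longleftrightarrow> - prefix_max c 1 \<le> c 1 \<and> c 1 \<le> 1 + prefix_max c 1"
    by (auto simp: prefix_max_Suc_0)
  ultimately show ?thesis
    unfolding coloring_vector_def prefix_bounded_def split ball_simps Let_def
    by (metis (no_types, lifting))
qed

section \<open>Old colors and uniqueness\<close>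

text \<open>The running maximum starts at 0 and grows by at most one per position, so it skips no
  positive value. The range reaches \<open>Suc n\<close> because \<open>prefix_max c i\<close> only
  looks at positions before \<open>i\<close>.\<close>

lemma prefix_bounded_surj:
  assumes "prefix_bounded n c" "i \<le> Suc n" "1 \<le> k" "k \<le> prefix_max c i"
  shows "\<exists>j\<in>{1..<i}. c j = k"
  using assms(2,4)
proof (induction i)
  case 0
  then show ?case
    using assms(3) by (simp add: prefix_max_def)
next
  case (Suc i)
  show ?case
  proof (cases "i = 0")
    case True
    then show ?thesis
      using Suc.prems assms(3) by (simp add: prefix_max_Suc_0)
  next
    case False
    show ?thesis
    proof (cases "k \<le> prefix_max c i")
      case True
      then show ?thesis
        using Suc.IH Suc.prems by (force simp: less_Suc_eq)
    next
      case *: False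
      have "c i \<le> 1 + prefix_max c i"
        using assms(1) False Suc.prems by (simp add: prefix_bounded_def)
      \<comment> \<open>Here \<open>k\<close> exceeds the old maximum but not the new one, so the
        new one is \<open>c i\<close>, and \<open>k\<close> is squeezed between 1 plus the old
        maximum and \<open>c i\<close>.\<close>
      then have "c i = k"
        using * False Suc.prems by (simp add: prefix_max_Suc)
      then show ?thesis
        using False by force
    qed
  qed
qed

lemma prefix_bounded_old_color:
  assumes "prefix_bounded n c" "i \<in> {1..n}" "c i \<noteq> 1 + prefix_max c i" "c i \<noteq> 0"
  shows "\<exists>j\<in>{1..<i}. c j = \<bar>c i\<bar>"
proof -
  have "- prefix_max c i \<le> c i \<and> c i \<le> 1 + prefix_max c i"
    using assms(1,2) by (auto simp: prefix_bounded_def)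
  then have "\<bar>c i\<bar> \<le> prefix_max c i"
    using assms(3) by auto
  then show ?thesis
    using prefix_bounded_surj[OF assms(1)] assms(2,4) by auto
qed

text \<open>An old nonzero color occurs earlier up to sign, and there \<open>c\<close> and
  \<open>d\<close> agree. The hypotheses \<open>same\<close> and \<open>opp\<close> are one-way
  implications and transport this to \<open>i\<close>; the lemma can then be applied with
  \<open>c\<close> and \<open>d\<close> exchanged.\<close>

lemma eq_of_old_color:
  assumes "prefix_bounded n c" "i \<in> {1..n}" "c i \<noteq> 1 + prefix_max c i"
    and same: "\<And>j k. \<lbrakk>j \<in> {1..n}; k \<in> {1..n}; c j = c k\<rbrakk> \<Longrightarrow> d j = d k"
    and opp: "\<And>j k. \<lbrakk>j \<in> {1..n}; k \<in> {1..n}; c j = - c k\<rbrakk> \<Longrightarrow> d j = - d k"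
    and prev: "\<And>j. \<lbrakk>1 \<le> j; j < i\<rbrakk> \<Longrightarrow> c j = d j"
  shows "c i = d i"
proof (cases "c i = 0")
  case True
  \<comment> \<open>Color 0 is its own negative, so \<open>opp\<close> pairs \<open>i\<close> with
    itself.\<close>
  then have "d i = - d i"
    using opp[of i i] assms(2) by simp
  then show ?thesis
    using True by simp
next
  case False
  then obtain j where j: "j \<in> {1..<i}" "c j = \<bar>c i\<bar>"
    using prefix_bounded_old_color assms(1-3) by blast
  have "j \<in> {1..n}"
    using j assms(2) by auto
  then have "c j = c i \<Longrightarrow> d j = d i" "c j = - c i \<Longrightarrow> d j = - d i"
    using same opp assms(2) by blast+
  moreover have "c j = d j"
    using prev j by simp
  ultimately show ?thesis
    using j(2) by (cases "c i \<ge> 0") auto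
qed

text \<open>By strong induction the prefix maxima at \<open>i\<close> agree. If \<open>c i\<close>
  or \<open>d i\<close> is an old color, \<open>eq_of_old_color\<close> applies in one direction or
  the other; otherwise both are 1 plus the common maximum.\<close>

lemma prefix_bounded_unique:
  assumes "prefix_bounded n c" "prefix_bounded n d"
    and same: "\<And>i j. i \<in> {1..n} \<Longrightarrow> j \<in> {1..n} \<Longrightarrow> c i = c j \<longleftrightarrow> d i = d j"
    and opp: "\<And>i j. i \<in> {1..n} \<Longrightarrow> j \<in> {1..n} \<Longrightarrow> c i = - c j \<longleftrightarrow> d i = - d j"
    and "i \<in> {1..n}"
  shows "c i = d i"
  using \<open>i \<in> {1..n}\<close>
proof (induction i rule: less_induct)
  case (less i)
  then have prev: "c j = d j" if "1 \<le> j" "j < i" for j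
    using that by simp
  then have "prefix_max c i = prefix_max d i"
    by (rule prefix_max_cong)
  moreover have "c i = d i" if "c i \<noteq> 1 + prefix_max c i"
    using eq_of_old_color[of n c i d] assms(1) less.prems that same opp prev by blast
  moreover have "d i = c i" if "d i \<noteq> 1 + prefix_max d i"
    using eq_of_old_color[of n d i c] assms(2) less.prems that same opp prev by metis
  ultimately show ?case
    by metis
qed

section \<open>Existence by induction on the length\<close>

text \<open>Here \<open>q i\<close> stands for the block of \<open>i\<close> and \<open>f\<close>
  for the involution. With blocks as abstract labels, the induction keeps the same \<open>q\<close>
  and \<open>f\<close> for every \<open>n\<close>, and no tagged partition has to be restricted to
  an initial segment.\<close>

lemma prefix_bounded_exists:
  fixes q :: "nat \<Rightarrow> 'b" and f :: "'b \<Rightarrow> 'b option"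
  assumes inv: "\<And>x y. f x = Some y \<Longrightarrow> f y = Some x"
    and fixed: "\<And>x y. f x = Some x \<Longrightarrow> f y = Some y \<Longrightarrow> x = y"
  shows "\<exists>c. prefix_bounded n c \<and> (\<forall>i\<in>{1..n}. \<forall>j\<in>{1..n}.
           (c i = c j \<longleftrightarrow> q i = q j) \<and> (c i = - c j \<longleftrightarrow> f (q i) = Some (q j)))"
proof (induction n)
  case 0
  show ?case
    by (simp add: prefix_bounded_def)
next
  case (Suc n)
  then obtain c where bounded: "prefix_bounded n c"
    and same: "\<And>i j. i \<in> {1..n} \<Longrightarrow> j \<in> {1..n} \<Longrightarrow> c i = c j \<longleftrightarrow> q i = q j"
    and opp: "\<And>i j. i \<in> {1..n} \<Longrightarrow> j \<in> {1..n} \<Longrightarrow> c i = - c j \<longleftrightarrow> f (q i) = Some (q j)"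
    by blast
  define N where "N = Suc n"
  define m where "m = prefix_max c N"
  have m0: "0 \<le> m"
    by (simp add: m_def prefix_max_nonneg)
  \<comment> \<open>All colors used so far lie between \<open>- m\<close> and \<open>m\<close>, so
    \<open>1 + m\<close> differs from each of them and from their negatives.\<close>
  have old: "- m \<le> c j \<and> c j \<le> m" if "j \<in> {1..n}" for j
  proof -
    have "- prefix_max c j \<le> c j"
      using bounded that by (simp add: prefix_bounded_def)
    moreover have "prefix_max c j \<le> m" "c j \<le> m"
      using that prefix_max_mono[of j N c] le_prefix_max[of j N c] by (simp_all add: m_def N_def)
    ultimately show ?thesis
      by simp
  qed
  \<comment> \<open>The color \<open>v\<close> of the new position \<open>N\<close>. The clause on
    \<open>v = - v\<close> covers the pair of \<open>N\<close> with itself, which the quantifier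
    over old positions misses.\<close>
  have "\<exists>v. - m \<le> v \<and> v \<le> 1 + m \<and> (v = - v \<longleftrightarrow> f (q N) = Some (q N)) \<and>
          (\<forall>j\<in>{1..n}. (v = c j \<longleftrightarrow> q N = q j) \<and> (v = - c j \<longleftrightarrow> f (q N) = Some (q j)))"
  proof -
    consider (zero) "f (q N) = Some (q N)"
      | (seen) j where "j \<in> {1..n}" "q N = q j"
      | (partner) j where "j \<in> {1..n}" "f (q N) = Some (q j)"
      | (fresh) "f (q N) \<noteq> Some (q N)" "\<And>j. j \<in> {1..n} \<Longrightarrow> q N \<noteq> q j \<and> f (q N) \<noteq> Some (q j)"
      by blast
    then show ?thesis
    proof cases
      case zero
      have "(0 = c j \<longleftrightarrow> q N = q j) \<and> (0 = - c j \<longleftrightarrow> f (q N) = Some (q j))" if "j \<in> {1..n}" for j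
      proof -
        \<comment> \<open>An old position has color 0 exactly when its label is fixed by
          \<open>f\<close>; as there is at most one fixed label, that label is
          \<open>q N\<close>.\<close>
        have "c j = 0 \<longleftrightarrow> f (q j) = Some (q j)"
          using opp[OF that that] by auto
        then show ?thesis
          using zero fixed[of "q N" "q j"] by auto
      qed
      then show ?thesis
        using zero m0 by (intro exI[of _ 0]) simp
    next
      case (seen j)
      then show ?thesis
        using old[OF seen(1)] same[OF seen(1)] opp[OF seen(1)] opp[OF seen(1) seen(1)]
        by (intro exI[of _ "c j"]) simp
    next
      case (partner j)
      have swap: "f (q j) = Some (q N)"
        using inv partner(2) .
      have "(- c j = c k \<longleftrightarrow> q N = q k) \<and> (- c j = - c k \<longleftrightarrow> f (q N) = Some (q k))"
        if "k \<in> {1..n}" for k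
      proof -
        have "- c j = c k \<longleftrightarrow> f (q j) = Some (q k)"
          using opp[OF partner(1) that]
          by auto
        then show ?thesis
          using same[OF partner(1) that] swap partner(2) by auto
      qed
      moreover have "- c j = - (- c j) \<longleftrightarrow> f (q N) = Some (q N)"
      proof -
        have "- c j = - (- c j) \<longleftrightarrow> f (q j) = Some (q j)"
          using opp[OF partner(1) partner(1)]
          by auto
        then show ?thesis
          using swap partner(2) by auto
      qed
      ultimately show ?thesis
        using old[OF partner(1)] by (intro exI[of _ "- c j"]) auto
    next
      case fresh
      then show ?thesis
        \<comment> \<open>The fresh color is positive because \<open>m\<close> is nonnegative, hence
          it is not its own negative.\<close>
        using old m0 by (intro exI[of _ "1 + m"]) force
    qed
  qed
  then obtain v where v: "- m \<le> v" "v \<le> 1 + m" "v = - v \<longleftrightarrow> f (q N) = Some (q N)"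
    "\<And>j. j \<in> {1..n} \<Longrightarrow> v = c j \<longleftrightarrow> q N = q j"
    "\<And>j. j \<in> {1..n} \<Longrightarrow> v = - c j \<longleftrightarrow> f (q N) = Some (q j)"
    by blast
  define d where "d = c(N := v)"
  have d: "d N = v" "\<And>j. j \<in> {1..n} \<Longrightarrow> d j = c j"
    by (auto simp: d_def N_def)
  have "prefix_max d N = m"
    unfolding m_def by (rule prefix_max_cong) (auto simp: d N_def)
  moreover have "prefix_bounded n d"
    using bounded prefix_bounded_cong[of n d c] d(2) by simp
  ultimately have "prefix_bounded N d"
    using v(1,2) d(1) by (simp add: N_def prefix_bounded_Suc)
  moreover have "(d i = d j \<longleftrightarrow> q i = q j) \<and> (d i = - d j \<longleftrightarrow> f (q i) = Some (q j))"
    if ij: "i \<in> insert N {1..n}" "j \<in> insert N {1..n}" for i j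
  proof -
    \<comment> \<open>The choice of \<open>v\<close> settles pairs with \<open>N\<close> in first
      place; symmetry of \<open>f\<close> gives those with \<open>N\<close> in second place.\<close>
    have "c j = v \<longleftrightarrow> q j = q N" "c j = - v \<longleftrightarrow> f (q j) = Some (q N)" if "j \<in> {1..n}" for j
      using v(4,5)[OF that] inv[of "q j" "q N"] inv[of "q N" "q j"] by auto
    then show ?thesis
      using ij d v(3-5) same opp by (metis insert_iff)
  qed
  moreover have "insert N {1..n} = {1..N}"
    by (auto simp: N_def)
  ultimately show ?case
    unfolding N_def by metis
qed

section \<open>Color classes and their involution\<close>

lemma color_class_eq_iff:
  "i \<in> {1..n} \<Longrightarrow> color_class n c i = color_class n c j \<longleftrightarrow> c i = c j"
  by (auto simp: color_class_def)

lemma opp_class_eq_color_class: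
  "c j = - c i \<Longrightarrow> opp_class n c i = color_class n c j"
  by (simp add: opp_class_def color_class_def)

text \<open>A nonempty opposite class is the color class of each of its members, so it equals the
  class of \<open>j\<close> exactly when it contains \<open>j\<close>.\<close>

lemma color_involution_eq_Some_iff:
  assumes "i \<in> {1..n}" "j \<in> {1..n}"
  shows "color_involution n c (color_class n c i) = Some (color_class n c j) \<longleftrightarrow> c i = - c j"
proof -
  have "j \<in> opp_class n c i \<longleftrightarrow> c i = - c j" "j \<in> color_class n c j"
    using assms(2) by (auto simp: opp_class_def color_class_def)
  then show ?thesis
    using color_involution_class[OF assms(1), of c] opp_class_eq_color_class[of c j i n] by auto
qed

lemma color_involution_SomeE:
  assumes "color_involution n c A = Some B"
  obtains i j where "i \<in> {1..n}" "j \<in> {1..n}" "A = color_class n c i" "B = color_class n c j"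
    "c i = - c j"
proof -
  obtain i where i: "i \<in> {1..n}" "A = color_class n c i" "opp_class n c i \<noteq> {}"
    using domI[of "color_involution n c", OF assms] unfolding dom_color_involution by auto
  then have B: "B = opp_class n c i"
    using assms by (simp add: color_involution_class)
  obtain j where j: "j \<in> {1..n}" "c j = - c i"
    using i(3) by (auto simp: opp_class_def)
  show thesis
    using that[OF i(1) j(1) i(2)] B j(2) opp_class_eq_color_class[OF j(2)] by fastforce
qed

lemma color_involution_sym:
  assumes "color_involution n c A = Some B"
  shows "color_involution n c B = Some A"
  using assms
proof (rule color_involution_SomeE)
  fix i j
  assume "i \<in> {1..n}" "j \<in> {1..n}" "A = color_class n c i" "B = color_class n c j" "c i = - c j"
  then show ?thesis
    by (simp add: color_involution_eq_Some_iff)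
qed

lemma partition_on_color_partition: "partition_on {1..n} (color_partition n c)"
  unfolding partition_on_def color_partition_def disjoint_def by (auto simp: color_class_def)

lemma tagged_partition_on_color_tagged_partition:
  "tagged_partition_on {1..n} (color_tagged_partition n c)"
proof -
  let ?f = "color_involution n c"
  have "dom ?f \<subseteq> color_partition n c"
    by (auto simp: dom_color_involution color_partition_def)
  moreover have "ran ?f \<subseteq> dom ?f"
    by (auto simp: ran_def dest: color_involution_sym)
  moreover have "(?f \<circ>\<^sub>m ?f) A = Some A" if "A \<in> dom ?f" for A
    using that by (auto simp: map_comp_def dest: color_involution_sym)
  moreover have "A = B" if AB: "?f A = Some A" "?f B = Some B" for A B
  proof -
    \<comment> \<open>Two representatives of a fixed class have both equal and opposite colors, so
      the color is 0; only one class has that color.\<close>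
    have zero: "\<exists>i\<in>{1..n}. A = color_class n c i \<and> c i = 0" if "?f A = Some A" for A
      using that
    proof (rule color_involution_SomeE)
      fix i j
      assume "i \<in> {1..n}" "j \<in> {1..n}" "A = color_class n c i" "A = color_class n c j" "c i = - c j"
      then show ?thesis
        using color_class_eq_iff[of i n c j] by auto
    qed
    show ?thesis
      using zero[OF AB(1)] zero[OF AB(2)] by (auto simp: color_class_def)
  qed
  ultimately show ?thesis
    using partition_on_color_partition
    by (simp add: tagged_partition_on_def color_tagged_partition_def partial_involution_on_def)
qed

text \<open>Both classes are blocks of one partition and share the point \<open>i\<close>.\<close>

lemma color_partition_eqD:
  assumes "color_partition n c = color_partition n d" "i \<in> {1..n}"
  shows "color_class n c i = color_class n d i"
proof -
  have mem: "color_class n e i \<in> color_partition n e" for e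
    using assms(2) by (simp add: color_partition_def)
  have "color_class n c i \<in> color_partition n d" "color_class n d i \<in> color_partition n d"
    using mem[of c] mem[of d] assms(1) by simp_all
  moreover have "i \<in> color_class n c i \<inter> color_class n d i"
    using assms(2) by (simp add: color_class_def)
  ultimately show ?thesis
    using partition_on_color_partition[of n d] unfolding partition_on_def disjoint_def by blast
qed

section \<open>Injectivity and surjectivity\<close>

text \<open>The blocks determine which entries are equal and the involution which are opposite, so
  \<open>prefix_bounded_unique\<close> applies on the index range; extensionality settles the
  rest.\<close>

lemma inj_on_color_tagged_partition:
  assumes "n \<ge> 1"
  shows "inj_on (color_tagged_partition n) {c. coloring_vector n c}"
proof (rule inj_onI)
  fix c d
  assume "c \<in> {c. coloring_vector n c}" "d \<in> {c. coloring_vector n c}"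
    and eq: "color_tagged_partition n c = color_tagged_partition n d"
  then have c: "c \<in> {1..n} \<rightarrow>\<^sub>E UNIV" "prefix_bounded n c"
    and d: "d \<in> {1..n} \<rightarrow>\<^sub>E UNIV" "prefix_bounded n d"
    using coloring_vector_iff[OF assms] by auto
  have cls: "color_class n c i = color_class n d i" if "i \<in> {1..n}" for i
    by (intro color_partition_eqD) (use eq that in \<open>simp_all add: color_tagged_partition_def\<close>)
  have inv: "color_involution n c = color_involution n d"
    using eq by (simp add: color_tagged_partition_def)
  have "c i = c j \<longleftrightarrow> d i = d j" if "i \<in> {1..n}" "j \<in> {1..n}" for i j
    using that color_class_eq_iff cls by metis
  moreover have "c i = - c j \<longleftrightarrow> d i = - d j" if "i \<in> {1..n}" "j \<in> {1..n}" for i j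
    using that color_involution_eq_Some_iff cls inv by metis
  ultimately have "c i = d i" if "i \<in> {1..n}" for i
    using prefix_bounded_unique[OF c(2) d(2)] that by blast
  then show "c = d"
    using PiE_ext[OF c(1) d(1)] by blast
qed

lemma color_tagged_partition_surj:
  assumes "n \<ge> 1" "tagged_partition_on {1..n} (P, f)"
  shows "\<exists>c. coloring_vector n c \<and> color_tagged_partition n c = (P, f)"
proof -
  have P: "\<Union>P = {1..n}" "\<And>A B. \<lbrakk>A \<in> P; B \<in> P; A \<noteq> B\<rbrakk> \<Longrightarrow> A \<inter> B = {}" "{} \<notin> P"
    and f: "dom f \<subseteq> P" "ran f \<subseteq> dom f" "\<And>A. A \<in> dom f \<Longrightarrow> (f \<circ>\<^sub>m f) A = Some A"
    and fixed: "\<And>A B. f A = Some A \<Longrightarrow> f B = Some B \<Longrightarrow> A = B"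
    using assms(2)
    by (auto simp: tagged_partition_on_def partition_on_def partial_involution_on_def disjoint_def)
  have inv: "f B = Some A" if "f A = Some B" for A B
    using f(3)[of A] that by (auto simp: map_comp_def)
  have "\<forall>i\<in>{1..n}. \<exists>A. A \<in> P \<and> i \<in> A"
    using P(1) by blast
  \<comment> \<open>The map \<open>q\<close> sends each position to its block, the labelling to
    which \<open>prefix_bounded_exists\<close> is applied.\<close>
  then obtain q where q: "\<And>i. i \<in> {1..n} \<Longrightarrow> q i \<in> P \<and> i \<in> q i"
    by metis
  have q_eq: "q i = A" if "A \<in> P" "i \<in> A" for i A
    using that P(1,2) q by blast
  obtain c0 where c0: "prefix_bounded n c0"
    "\<And>i j. i \<in> {1..n} \<Longrightarrow> j \<in> {1..n} \<Longrightarrow>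
       (c0 i = c0 j \<longleftrightarrow> q i = q j) \<and> (c0 i = - c0 j \<longleftrightarrow> f (q i) = Some (q j))"
    using prefix_bounded_exists[of f n q, OF inv fixed] by blast
  \<comment> \<open>Restricting sets the values outside the index range to \<open>undefined\<close>,
    as extensionality demands.\<close>
  define c where "c = restrict c0 {1..n}"
  have c: "coloring_vector n c"
    using c0(1) prefix_bounded_cong[of n c c0]
    by (simp add: coloring_vector_iff[OF assms(1)] c_def)
  have same: "c i = c j \<longleftrightarrow> q i = q j" and opp: "c i = - c j \<longleftrightarrow> f (q i) = Some (q j)"
    if "i \<in> {1..n}" "j \<in> {1..n}" for i j
    using c0(2)[OF that] that by (auto simp: c_def)
  have cls: "color_class n c i = q i" if "i \<in> {1..n}" for i
  proof -
    have "j \<in> q i \<longleftrightarrow> j \<in> {1..n} \<and> q j = q i" for j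
      using q q_eq P(1) that by blast
    then show ?thesis
      using same that by (auto simp: color_class_def)
  qed
  have P_eq: "P = q ` {1..n}"
  proof (intro equalityI subsetI)
    fix A
    assume "A \<in> P"
    then obtain i where "i \<in> A" "i \<in> {1..n}"
      using P(1,3) by (metis UnionI equals0I)
    then show "A \<in> q ` {1..n}"
      using q_eq \<open>A \<in> P\<close> by blast
  qed (use q in auto)
  have part: "color_partition n c = P"
    unfolding color_partition_def P_eq using cls by (rule image_cong[OF refl])
  \<comment> \<open>The two maps are compared through their graphs: both relate only blocks of
    \<open>P\<close>, and for blocks \<open>q i\<close> and \<open>q j\<close> either relation means
    \<open>c i = - c j\<close>.\<close>
  have inv_iff: "color_involution n c A = Some B \<longleftrightarrow> f A = Some B" for A B
  proof -
    have "A \<in> P \<and> B \<in> P" if "color_involution n c A = Some B"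
      using that by (rule color_involution_SomeE) (use part in \<open>auto simp: color_partition_def\<close>)
    moreover have "A \<in> P \<and> B \<in> P" if "f A = Some B"
      using that f(1) inv by blast
    moreover have "color_involution n c A = Some B \<longleftrightarrow> f A = Some B" if AB: "A \<in> P \<and> B \<in> P"
    proof -
      obtain i j where ij: "i \<in> {1..n}" "j \<in> {1..n}" "A = q i" "B = q j"
        using AB unfolding P_eq by blast
      then show ?thesis
        using color_involution_eq_Some_iff[OF ij(1,2), of c] opp cls by simp
    qed
    ultimately show ?thesis
      by blast
  qed
  have "color_involution n c A = f A" for A
    using inv_iff[of A] by (cases "f A"; cases "color_involution n c A") auto
  then show ?thesis
    using c part by (auto simp: color_tagged_partition_def)
qed

theorem proposition3p7:
  fixes n :: nat
  assumes "n \<ge> 1"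
  shows "bij_betw (color_tagged_partition n)
           {c. coloring_vector n c} {T. tagged_partition_on {1..n} T}"
  unfolding bij_betw_def
proof
  show "inj_on (color_tagged_partition n) {c. coloring_vector n c}"
    using assms by (rule inj_on_color_tagged_partition)
  show "color_tagged_partition n ` {c. coloring_vector n c} = {T. tagged_partition_on {1..n} T}"
  proof (intro equalityI subsetI)
    fix T
    assume "T \<in> {T. tagged_partition_on {1..n} T}"
    then show "T \<in> color_tagged_partition n ` {c. coloring_vector n c}"
      using color_tagged_partition_surj[OF assms, of "fst T" "snd T"] by force
  qed (use tagged_partition_on_color_tagged_partition in blast)
qed

end
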